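(* Let $n\ge 2$ and let $f_0(x,\theta)=(x+1,\theta)$, $h_0(x,\theta)=(nx,\theta+\ln n)$ be the generators of the standard $BS(1,n)$-action on $\mathbb T^2=(\mathbb R\cup\{\infty\})\times S^1$. There exist $C^\infty$ faithful $BS(1,n)$-actions $\langle f,h\rangle$ on $\mathbb T^2$, with $(f,h)$ arbitrarily $C^\infty$-close to $(f_0,h_0)$, that are not topologically conjugate to $\langle f_0,h_0\rangle$.
   Context: $BS(1,n)=\langle a,b\mid aba^{-1}=b^n\rangle$. The circle $\mathbb R\cup\{\infty\}$ is the real projective line with its usual smooth structure and $S^1=\mathbb R/\mathbb Z$. A $C^\infty$ $BS(1,n)$-action $\langle f,h\rangle$ is given by $C^\infty$ diffeomorphisms $f,h$ with $h\circ f\circ h^{-1}=f^n$ ($b$ acts by $f$, $a$ by $h$); it is faithful if the induced homomorphism from $BS(1,n)$ is injective. Two actions $\langle f,h\rangle$ and $\langle f_1,h_1\rangle$ are topologically conjugate if there is a homeomorphism $H$ with $H\circ f\circ H^{-1}=f_1$ and $H\circ h\circ H^{-1}=h_1$. *)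

theory Defs
  imports "HOL-Analysis.Analysis" "HOL-Algebra.Group"
begin

unbundle no m_inv_syntax

section \<open>Groups given by generators and relations\<close>

text \<open>A letter \<open>(x, True)\<close> stands for the generator \<open>x\<close> and \<open>(x, False)\<close> for its inverse;
  a pair \<open>(u, v)\<close> of words in \<open>R\<close> stands for the relation \<open>u = v\<close>.\<close>

type_synonym 'g word = "('g \<times> bool) list"

inductive word_cong :: "('g word \<times> 'g word) set \<Rightarrow> 'g word \<Rightarrow> 'g word \<Rightarrow> bool"
  for R :: "('g word \<times> 'g word) set"
where
  word_cong_refl: "word_cong R u u"
| word_cong_sym: "word_cong R u v \<Longrightarrow> word_cong R v u"
| word_cong_trans: "word_cong R u v \<Longrightarrow> word_cong R v w \<Longrightarrow> word_cong R u w"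
| word_cong_append: "word_cong R u u' \<Longrightarrow> word_cong R v v' \<Longrightarrow> word_cong R (u @ v) (u' @ v')"
| word_cong_cancel: "word_cong R [(x, e), (x, \<not> e)] []"
| word_cong_rel: "(u, v) \<in> R \<Longrightarrow> word_cong R u v"

definition word_class :: "('g word \<times> 'g word) set \<Rightarrow> 'g word \<Rightarrow> 'g word set" where
  "word_class R u = {v. word_cong R u v}"

definition presented_group :: "('g word \<times> 'g word) set \<Rightarrow> 'g word set monoid" where
  "presented_group R =
     \<lparr>carrier = range (word_class R),
      mult = (\<lambda>X Y. \<Union>u\<in>X. \<Union>v\<in>Y. word_class R (u @ v)),
      one = word_class R []\<rparr>"

lemma word_class_eq_iff: "word_class R u = word_class R v \<longleftrightarrow> word_cong R u v"
proof
  assume "word_class R u = word_class R v"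
  moreover have "v \<in> word_class R v"
    by (simp add: word_class_def word_cong_refl)
  ultimately have "v \<in> word_class R u"
    by (simp only:)
  then show "word_cong R u v"
    by (simp add: word_class_def)
next
  assume uv: "word_cong R u v"
  show "word_class R u = word_class R v"
    unfolding word_class_def
    using word_cong_trans[OF uv] word_cong_trans[OF word_cong_sym[OF uv]] by blast
qed

lemma mult_word_class:
  "word_class R u \<otimes>\<^bsub>presented_group R\<^esub> word_class R v = word_class R (u @ v)"
proof -
  have "word_class R (u' @ v') = word_class R (u @ v)"
    if "u' \<in> word_class R u" "v' \<in> word_class R v" for u' v'
  proof -
    from that have "word_cong R u u'" "word_cong R v v'"
      unfolding word_class_def by blast+
    then have "word_cong R (u' @ v') (u @ v)"
      by (intro word_cong_sym[OF word_cong_append])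
    then show ?thesis
      unfolding word_class_eq_iff .
  qed
  then have "(\<Union>u'\<in>word_class R u. \<Union>v'\<in>word_class R v. word_class R (u' @ v')) =
      (\<Union>u'\<in>word_class R u. \<Union>v'\<in>word_class R v. word_class R (u @ v))"
    by (intro SUP_cong refl)
  moreover have "u \<in> word_class R u" "v \<in> word_class R v"
    unfolding word_class_def by (blast intro: word_cong_refl)+
  then have "(\<Union>u'\<in>word_class R u. \<Union>v'\<in>word_class R v. word_class R (u @ v)) =
      word_class R (u @ v)"
    by blast
  ultimately show ?thesis
    unfolding presented_group_def monoid.simps by (rule trans)
qed

lemma word_cong_inverse:
  "word_cong R (rev (map (\<lambda>(x, e). (x, \<not> e)) u) @ u) []"
proof (induction u)
  case Nil
  show ?case by (simp add: word_cong_refl)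
next
  case (Cons l u)
  obtain x e where l: "l = (x, e)" by (cases l)
  let ?i = "rev (map (\<lambda>(x, e). (x, \<not> e)) u)"
  have "word_cong R [(x, \<not> e), (x, e)] []"
    using word_cong_cancel[of R x "\<not> e"] by simp
  then have "word_cong R (?i @ ([(x, \<not> e), (x, e)] @ u)) (?i @ ([] @ u))"
    by (intro word_cong_append word_cong_refl)
  then have "word_cong R (rev (map (\<lambda>(x, e). (x, \<not> e)) (l # u)) @ l # u) (?i @ u)"
    by (simp add: l)
  then show ?case
    using Cons.IH by (rule word_cong_trans)
qed

lemma group_presented_group: "group (presented_group R)"
proof -
  have carr: "carrier (presented_group R) = range (word_class R)"
    and one: "\<one>\<^bsub>presented_group R\<^esub> = word_class R []"
    by (simp_all add: presented_group_def)
  have inv: "word_class R (rev (map (\<lambda>(x, e). (x, \<not> e)) u))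
      \<otimes>\<^bsub>presented_group R\<^esub> word_class R u = word_class R []" for u
    by (simp add: mult_word_class word_class_eq_iff word_cong_inverse)
  show ?thesis
  proof (rule groupI)
    show "\<exists>Y\<in>carrier (presented_group R). Y \<otimes>\<^bsub>presented_group R\<^esub> X = \<one>\<^bsub>presented_group R\<^esub>"
      if "X \<in> carrier (presented_group R)" for X
      using that inv unfolding carr one by blast
  qed (use carr one in \<open>auto simp: mult_word_class\<close>)
qed

datatype bs_gen = gen_a | gen_b

definition BS1_rel :: "nat \<Rightarrow> (bs_gen word \<times> bs_gen word) set" where
  "BS1_rel n = {([(gen_a, True), (gen_b, True), (gen_a, False)], replicate n (gen_b, True))}"

definition BS1 :: "nat \<Rightarrow> bs_gen word set monoid" where
  "BS1 n = presented_group (BS1_rel n)"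

section \<open>The torus\<close>

type_synonym proj_line = "real option"  \<comment> \<open>\<open>None\<close> is the point at infinity\<close>

quotient_type circle = real / "\<lambda>x y. x - y \<in> \<int>"
  morphisms rep_circle to_circle
proof (rule equivpI)
  show "reflp (\<lambda>x y::real. x - y \<in> \<int>)"
    by (simp add: reflp_def)
  show "symp (\<lambda>x y::real. x - y \<in> \<int>)"
    by (metis (mono_tags, lifting) Ints_minus minus_diff_eq sympI)
  show "transp (\<lambda>x y::real. x - y \<in> \<int>)"
    by (rule transpI) (metis Ints_add diff_add_cancel add_diff_eq)
qed

instantiation circle :: topological_space
begin

definition open_circle :: "circle set \<Rightarrow> bool" where
  "open_circle U \<longleftrightarrow> open (to_circle -` U)"

instance
proof
  show "open (UNIV :: circle set)"
    by (simp add: open_circle_def)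
  show "open (S \<inter> T)" if "open S" "open T" for S T :: "circle set"
    using that by (simp add: open_circle_def open_Int)
  show "open (\<Union>K)" if "\<forall>S\<in>K. open S" for K :: "circle set set"
    using that by (auto simp: open_circle_def vimage_Union)
qed

end

lift_definition rotate_circle :: "real \<Rightarrow> circle \<Rightarrow> circle" is "\<lambda>s t. t + s"
  by simp

type_synonym torus = "proj_line \<times> circle"

definition torus_top :: "torus topology" where
  "torus_top = prod_topology (Alexandroff_compactification euclidean) euclidean"

text \<open>A chart is a pair of its domain and its coordinate map, the latter being relevant
  only on the domain.\<close>

type_synonym ('m, 'e) chart = "'m set \<times> ('m \<Rightarrow> 'e)"

text \<open>The affine chart of the real projective line, and the chart \<open>x \<mapsto> 1/x\<close> around infinity.\<close>

definition proj_line_atlas :: "(proj_line, real) chart set" where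
  "proj_line_atlas =
     {(range Some, the),
      (UNIV - {Some 0}, \<lambda>p. case p of None \<Rightarrow> 0 | Some x \<Rightarrow> 1 / x)}"

text \<open>The local inverses of the projection \<open>\<real> \<rightarrow> \<real>/\<int>\<close> on open intervals of length 1.\<close>

definition circle_atlas :: "(circle, real) chart set" where
  "circle_atlas = {(to_circle ` {c<..<c + 1}, inv_into {c<..<c + 1} to_circle) | c. True}"

definition torus_atlas :: "(torus, real \<times> real) chart set" where
  "torus_atlas =
     {(U \<times> V, map_prod \<phi> \<psi>) | U \<phi> V \<psi>. (U, \<phi>) \<in> proj_line_atlas \<and> (V, \<psi>) \<in> circle_atlas}"

section \<open>Smooth maps and the smooth topology\<close>

text \<open>The iterated directional derivative of \<open>g\<close> along the vectors of a list.\<close>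

fun iter_deriv :: "'a::euclidean_space list \<Rightarrow> ('a \<Rightarrow> 'b::euclidean_space) \<Rightarrow> 'a \<Rightarrow> 'b" where
  "iter_deriv [] g = g"
| "iter_deriv (v # vs) g = iter_deriv vs (\<lambda>x. frechet_derivative g (at x) v)"

text \<open>To be used for open \<open>S\<close>. The case \<open>vs = []\<close> is the differentiability of \<open>g\<close> itself.\<close>

definition smooth_on :: "'a::euclidean_space set \<Rightarrow> ('a \<Rightarrow> 'b::euclidean_space) \<Rightarrow> bool" where
  "smooth_on S g \<longleftrightarrow> (\<forall>vs. \<forall>x\<in>S. iter_deriv vs g differentiable (at x))"

text \<open>The expression of a map in charts. It is meaningful only on the image under the first
  chart of the points of its domain that are mapped into the domain of the second chart.\<close>

definition in_charts ::
  "(torus, real \<times> real) chart \<Rightarrow> (torus, real \<times> real) chart \<Rightarrow> (torus \<Rightarrow> torus)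
     \<Rightarrow> real \<times> real \<Rightarrow> real \<times> real" where
  "in_charts c d f = snd d \<circ> f \<circ> inv_into (fst c) (snd c)"

definition smooth_torus_map :: "(torus \<Rightarrow> torus) \<Rightarrow> bool" where
  "smooth_torus_map f \<longleftrightarrow>
     continuous_map torus_top torus_top f \<and>
     (\<forall>c\<in>torus_atlas. \<forall>d\<in>torus_atlas.
        smooth_on (snd c ` (fst c \<inter> f -` fst d)) (in_charts c d f))"

definition torus_diffeo :: "(torus \<Rightarrow> torus) \<Rightarrow> bool" where
  "torus_diffeo f \<longleftrightarrow> bij f \<and> smooth_torus_map f \<and> smooth_torus_map (inv f)"

definition diffeo_group :: "(torus \<Rightarrow> torus) monoid" where
  "diffeo_group = \<lparr>carrier = Collect torus_diffeo, mult = (\<circ>), one = id\<rparr>"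

text \<open>The smooth maps \<open>g\<close> that map \<open>K\<close> into the domain of \<open>d\<close> and whose partial derivatives
  up to order \<open>r\<close> are \<open>\<epsilon>\<close>-close to those of \<open>f\<close> on \<open>K\<close>, in the charts \<open>c\<close> and \<open>d\<close>. Here \<open>K\<close>
  is a compact subset of the domain of \<open>c\<close> that \<open>f\<close> maps into the domain of \<open>d\<close>.\<close>

definition smooth_nbhd ::
  "(torus \<Rightarrow> torus) \<Rightarrow> (torus, real \<times> real) chart \<Rightarrow> (torus, real \<times> real) chart
     \<Rightarrow> torus set \<Rightarrow> nat \<Rightarrow> real \<Rightarrow> (torus \<Rightarrow> torus) set" where
  "smooth_nbhd f c d K r \<epsilon> =
     {g. smooth_torus_map g \<and> g ` K \<subseteq> fst d \<and>
         (\<forall>vs. set vs \<subseteq> Basis \<and> length vs \<le> r \<longrightarrow>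
            (\<forall>x\<in>snd c ` K.
               norm (iter_deriv vs (in_charts c d g) x - iter_deriv vs (in_charts c d f) x) < \<epsilon>))}"

text \<open>The topology of uniform convergence of all derivatives on the set of all smooth maps
  of the torus.\<close>

definition smooth_subbasis :: "(torus \<Rightarrow> torus) set set" where
  "smooth_subbasis =
     {smooth_nbhd f c d K r \<epsilon> | f c d K r \<epsilon>.
        smooth_torus_map f \<and> c \<in> torus_atlas \<and> d \<in> torus_atlas \<and>
        compactin torus_top K \<and> K \<subseteq> fst c \<and> f ` K \<subseteq> fst d \<and> \<epsilon> > 0}"

definition smooth_topology :: "(torus \<Rightarrow> torus) topology" where
  "smooth_topology = topology_generated_by smooth_subbasis"

lemma topspace_smooth_topology: "topspace smooth_topology = Collect smooth_torus_map"
proof -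
  have "(range Some \<times> to_circle ` {0<..<0 + 1},
      map_prod the (inv_into {0<..<0 + 1} to_circle)) \<in> torus_atlas"
    unfolding torus_atlas_def proj_line_atlas_def circle_atlas_def by blast
  then obtain c where c: "c \<in> torus_atlas" ..
  show ?thesis
    unfolding smooth_topology_def topology_generated_by_topspace
  proof (intro equalityI subsetI)
    fix g assume "g \<in> \<Union>smooth_subbasis"
    then show "g \<in> Collect smooth_torus_map"
      unfolding smooth_subbasis_def smooth_nbhd_def by auto
  next
    fix g assume "g \<in> Collect smooth_torus_map"
    then have g: "smooth_torus_map g"
      by simp
    have "compactin torus_top {}" "{} \<subseteq> fst c" "g ` {} \<subseteq> fst c" "(1::real) > 0"
      by simp_all
    with g c have "smooth_nbhd g c c {} 0 1 \<in> smooth_subbasis"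
      unfolding smooth_subbasis_def by blast
    moreover from g have "g \<in> smooth_nbhd g c c {} 0 1"
      unfolding smooth_nbhd_def by simp
    ultimately show "g \<in> \<Union>smooth_subbasis"
      by (rule UnionI)
  qed
qed

section \<open>Actions\<close>

definition smooth_BS1_action :: "nat \<Rightarrow> (torus \<Rightarrow> torus) \<Rightarrow> (torus \<Rightarrow> torus) \<Rightarrow> bool" where
  "smooth_BS1_action n f h \<longleftrightarrow>
     torus_diffeo f \<and> torus_diffeo h \<and> h \<circ> f \<circ> inv h = f ^^ n"

text \<open>The homomorphism \<open>\<rho>\<close> is determined by its values on the generators.\<close>

definition faithful_BS1_action :: "nat \<Rightarrow> (torus \<Rightarrow> torus) \<Rightarrow> (torus \<Rightarrow> torus) \<Rightarrow> bool" where
  "faithful_BS1_action n f h \<longleftrightarrow>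
     smooth_BS1_action n f h \<and>
     (\<exists>\<rho>\<in>hom (BS1 n) diffeo_group.
        \<rho> (word_class (BS1_rel n) [(gen_b, True)]) = f \<and>
        \<rho> (word_class (BS1_rel n) [(gen_a, True)]) = h \<and>
        inj_on \<rho> (carrier (BS1 n)))"

definition topologically_conjugate ::
  "(torus \<Rightarrow> torus) \<Rightarrow> (torus \<Rightarrow> torus) \<Rightarrow> (torus \<Rightarrow> torus) \<Rightarrow> (torus \<Rightarrow> torus) \<Rightarrow> bool" where
  "topologically_conjugate f h f\<^sub>1 h\<^sub>1 \<longleftrightarrow>
     (\<exists>H. homeomorphic_map torus_top torus_top H \<and>
          H \<circ> f \<circ> inv H = f\<^sub>1 \<and> H \<circ> h \<circ> inv H = h\<^sub>1)"

definition f\<^sub>0 :: "torus \<Rightarrow> torus" where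
  "f\<^sub>0 = map_prod (map_option (\<lambda>x. x + 1)) id"

definition h\<^sub>0 :: "nat \<Rightarrow> torus \<Rightarrow> torus" where
  "h\<^sub>0 n = map_prod (map_option (\<lambda>x. real n * x)) (rotate_circle (ln (real n)))"

end

theory Submission
  imports Defs "HOL-Computational_Algebra.Polynomial"
begin

text \<open>
  The perturbation only changes the rotation angle: keep \<open>f\<^sub>0\<close> and replace \<open>h\<^sub>0\<close> by
  \<open>h\<^sub>s (x, \<theta>) = (n x, \<theta> + s)\<close>. The relation \<open>h\<^sub>s f\<^sub>0 h\<^sub>s\<^sup>-\<^sup>1 = f\<^sub>0\<^sup>n\<close> only
  concerns the first coordinate, and so does faithfulness, because the affine group of the line
  already contains a faithful copy of \<open>BS(1,n)\<close> (\<open>BS1_action_faithful\<close>).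

  A conjugacy from \<open>\<langle>f\<^sub>0, h\<^sub>s\<rangle>\<close> to \<open>\<langle>f\<^sub>0, h\<^sub>0\<rangle>\<close> preserves the circle at infinity, the fixed
  point set of \<open>f\<^sub>0\<close>, and conjugates there the rotation by \<open>s\<close> to the rotation by \<open>ln n\<close>. So it
  cannot exist if, for some \<open>q\<close>, exactly one of \<open>q s\<close> and \<open>q ln n\<close> is an integer
  (\<open>conjugate_fixed_circle_rotations\<close>). Such \<open>s\<close> exist arbitrarily close to \<open>ln n\<close>
  (\<open>dense_angles_of_different_order\<close>), and \<open>h\<^sub>s\<close> depends continuously on \<open>s\<close> in the smooth
  topology (\<open>continuous_map_rotation_angle\<close>).

  The analytic work is in that last fact and in the smoothness of \<open>f\<^sub>0\<close> and \<open>h\<^sub>s\<close>. Both come from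
  one description in charts (\<open>affine_torus_map_in_charts\<close>): locally, and jointly in the angle
  \<open>s\<close> and the point, the map is \<open>(x, t) \<mapsto> (p x / q x, t + s + k)\<close> with polynomials \<open>p\<close> and \<open>q\<close>
  and a constant \<open>k\<close>.
\<close>

section \<open>Iterated directional derivatives\<close>

text \<open>Smoothness quantifies over derivatives of every order. It is enough to put the map in a class
  of differentiable maps that directional differentiation does not leave: no formula for the
  higher derivatives is then required.\<close>

lemma smooth_onI_closed_class:
  fixes g :: "'a::euclidean_space \<Rightarrow> 'b::euclidean_space"
  assumes g: "P g"
    and diff: "\<And>g x. P g \<Longrightarrow> x \<in> S \<Longrightarrow> g differentiable (at x)"
    and deriv: "\<And>g v. P g \<Longrightarrow> P (\<lambda>x. frechet_derivative g (at x) v)"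
  shows "smooth_on S g"
proof -
  have "P (iter_deriv vs g)" for vs
    using g by (induction vs arbitrary: g) (auto intro: deriv)
  with diff show ?thesis
    unfolding smooth_on_def by blast
qed

text \<open>In the charts of the torus, all maps considered below have this form. The class to use consists
  of the maps \<open>(x, t) \<mapsto> (p x / q x, a t + b)\<close>: differentiating in direction \<open>v\<close> replaces
  \<open>p / q\<close> by \<open>v\<^sub>1 (p' q - p q') / q\<^sup>2\<close> and \<open>a t + b\<close> by the constant \<open>a v\<^sub>2\<close>.\<close>

lemma smooth_on_rational_times_translation:
  fixes p q :: "real poly" and S :: "(real \<times> real) set"
  assumes S: "open S"
    and g: "\<And>z. z \<in> S \<Longrightarrow>
      poly q (fst z) \<noteq> 0 \<and> g z = (poly p (fst z) / poly q (fst z), snd z + s)"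
  shows "smooth_on S g"
proof -
  define P where "P g \<longleftrightarrow> (\<exists>p q a b. \<forall>z\<in>S.
      poly q (fst z) \<noteq> 0 \<and> g z = (poly p (fst z) / poly q (fst z), a * snd z + b))"
    for g :: "real \<times> real \<Rightarrow> real \<times> real"
  have D: "\<exists>p q a. \<forall>z\<in>S. poly q (fst z) \<noteq> 0 \<and>
      (g has_derivative (\<lambda>v. (fst v * (poly p (fst z) / poly q (fst z)), a * snd v))) (at z)"
    if Pg: "P g" for g
  proof -
    from Pg obtain p q a b where pq: "\<And>z. z \<in> S \<Longrightarrow>
        poly q (fst z) \<noteq> 0 \<and> g z = (poly p (fst z) / poly q (fst z), a * snd z + b)"
      unfolding P_def by blast
    have "poly (q * q) (fst z) \<noteq> 0 \<and> (g has_derivative (\<lambda>v. (fst v *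
        (poly (pderiv p * q - p * pderiv q) (fst z) / poly (q * q) (fst z)), a * snd v))) (at z)"
      if z: "z \<in> S" for z
    proof
      show "poly (q * q) (fst z) \<noteq> 0"
        using pq[OF z] by simp
      have "((\<lambda>x. poly p x / poly q x) has_field_derivative
          poly (pderiv p * q - p * pderiv q) (fst z) / poly (q * q) (fst z)) (at (fst z))"
        using pq[OF z] by (auto intro!: derivative_eq_intros)
      from DERIV_compose_FDERIV[OF this has_derivative_fst[OF has_derivative_ident]]
      have "((\<lambda>z. (poly p (fst z) / poly q (fst z), a * snd z + b)) has_derivative (\<lambda>v. (fst v *
        (poly (pderiv p * q - p * pderiv q) (fst z) / poly (q * q) (fst z)), a * snd v))) (at z)"
        by (rule has_derivative_eq_rhs[OF has_derivative_Pair[OF _ has_derivative_add_const[OF has_derivative_mult_right[OF has_derivative_snd[OF has_derivative_ident]]]]]) simp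
      then show "(g has_derivative (\<lambda>v. (fst v *
        (poly (pderiv p * q - p * pderiv q) (fst z) / poly (q * q) (fst z)), a * snd v))) (at z)"
        by (rule has_derivative_transform_within_open[OF _ S z]) (use pq in auto)
    qed
    then show ?thesis by blast
  qed
  show ?thesis
  proof (rule smooth_onI_closed_class[where P = P])
    have "\<forall>z\<in>S. poly q (fst z) \<noteq> 0 \<and> g z = (poly p (fst z) / poly q (fst z), 1 * snd z + s)"
      using g by simp
    then show "P g"
      unfolding P_def by blast
  next
    show "g differentiable (at x)" if "P g" "x \<in> S" for g x
      using D[OF that(1)] that(2) unfolding differentiable_def by blast
  next
    fix g v assume "P g"
    from D[OF this] obtain p q a where pq: "\<And>z. z \<in> S \<Longrightarrow> poly q (fst z) \<noteq> 0 \<and>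
        (g has_derivative (\<lambda>v. (fst v * (poly p (fst z) / poly q (fst z)), a * snd v))) (at z)"
      by blast
    have "poly q (fst z) \<noteq> 0 \<and> frechet_derivative g (at z) v =
        (poly (smult (fst v) p) (fst z) / poly q (fst z), 0 * snd z + a * snd v)" if z: "z \<in> S" for z
    proof -
      have "frechet_derivative g (at z) =
          (\<lambda>v. (fst v * (poly p (fst z) / poly q (fst z)), a * snd v))"
        by (rule frechet_derivative_at[OF conjunct2[OF pq[OF z]], symmetric])
      then show ?thesis
        using pq[OF z] by simp
    qed
    then show "P (\<lambda>x. frechet_derivative g (at x) v)"
      unfolding P_def by blast
  qed
qed

lemma frechet_derivative_eventually_translate:
  assumes "\<forall>\<^sub>F z in nhds x. g' z = g z + c"
  shows "frechet_derivative g' (at x) = frechet_derivative g (at x)"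
proof -
  have transfer: "(k has_derivative D) (at x)"
    if "\<forall>\<^sub>F z in nhds x. k z = l z + c" "(l has_derivative D) (at x)" for k l c D
  proof -
    from that(1) have "\<forall>\<^sub>F z in at x. l z + c = k z" "l x + c = k x"
      by (auto simp: eventually_at_filter elim: eventually_mono dest: eventually_nhds_x_imp_x)
    with has_derivative_add_const[OF that(2), of c] show ?thesis
      by (rule has_derivative_transform_eventually) simp
  qed
  have "\<forall>\<^sub>F z in nhds x. g z = g' z + - c"
    using assms by (rule eventually_mono) simp
  from transfer[OF this] transfer[OF assms]
  have "(g' has_derivative D) (at x) \<longleftrightarrow> (g has_derivative D) (at x)" for D
    by blast
  then show ?thesis
    unfolding frechet_derivative_def by simp
qed

lemma iter_deriv_eventually_cong:
  assumes "\<forall>\<^sub>F z in nhds x. g' z = g z"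
  shows "iter_deriv vs g' x = iter_deriv vs g x"
  using assms
proof (induction vs arbitrary: g g')
  case Nil
  then show ?case by (auto dest: eventually_nhds_x_imp_x)
next
  case (Cons v vs)
  have "\<forall>\<^sub>F y in nhds x. \<forall>\<^sub>F z in nhds y. g' z = g z"
    using Cons.prems by (simp add: eventually_eventually)
  then have "\<forall>\<^sub>F y in nhds x. frechet_derivative g' (at y) v = frechet_derivative g (at y) v"
    by (rule eventually_mono) (simp add: frechet_derivative_eventually_translate[where c = 0])
  from Cons.IH[OF this] show ?case by simp
qed

text \<open>This is why changing the rotation angle does not move the partial derivatives of positive order
  at all: in charts, two rotations differ locally by a constant.\<close>

lemma iter_deriv_eventually_translate:
  assumes "\<forall>\<^sub>F z in nhds x. g' z = g z + c"
  shows "iter_deriv (v # vs) g' x = iter_deriv (v # vs) g x"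
proof -
  have "\<forall>\<^sub>F y in nhds x. \<forall>\<^sub>F z in nhds y. g' z = g z + c"
    using assms by (simp add: eventually_eventually)
  then have "\<forall>\<^sub>F y in nhds x. frechet_derivative g' (at y) v = frechet_derivative g (at y) v"
    by (rule eventually_mono) (simp add: frechet_derivative_eventually_translate[where c = c])
  from iter_deriv_eventually_cong[OF this] show ?thesis by simp
qed

section \<open>Affine maps of the torus\<close>

lemma rotate_circle_to_circle [simp]: "rotate_circle s (to_circle t) = to_circle (t + s)"
  by (rule rotate_circle.abs_eq)

lemma to_circle_eq_iff: "to_circle x = to_circle y \<longleftrightarrow> x - y \<in> \<int>"
  by (rule circle.abs_eq_iff)

lemma circle_cases: obtains t where "z = to_circle t"
  using Quotient_rel_rep[OF Quotient_circle] Quotient_abs_rep[OF Quotient_circle] by metis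

lemma rotate_circle_rotate_circle: "rotate_circle s (rotate_circle t z) = rotate_circle (s + t) z"
  by (rule circle_cases[of z]) (simp add: ac_simps)

lemma rotate_circle_eq_self_iff: "rotate_circle s z = z \<longleftrightarrow> s \<in> \<int>"
  by (rule circle_cases[of z]) (simp add: to_circle_eq_iff)

text \<open>Both generators belong to this family, as do their inverses and all products of them. Statements
  on single diffeomorphisms are proved once, for the family.\<close>

definition affine_torus_map :: "real \<Rightarrow> real \<Rightarrow> real \<Rightarrow> torus \<Rightarrow> torus" where
  "affine_torus_map \<alpha> \<beta> s = map_prod (map_option (\<lambda>x. \<alpha> * x + \<beta>)) (rotate_circle s)"

lemma f0_eq_affine: "f\<^sub>0 = affine_torus_map 1 1 0"
proof -
  have "rotate_circle 0 = id"
    by (auto simp: fun_eq_iff rotate_circle_eq_self_iff)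
  then show ?thesis
    by (simp add: f\<^sub>0_def affine_torus_map_def)
qed

lemma h0_eq_affine: "h\<^sub>0 n = affine_torus_map (real n) 0 (ln (real n))"
  by (simp add: h\<^sub>0_def affine_torus_map_def)

lemma affine_torus_map_compose:
  "affine_torus_map \<alpha> \<beta> s \<circ> affine_torus_map \<alpha>' \<beta>' s' =
     affine_torus_map (\<alpha> * \<alpha>') (\<alpha> * \<beta>' + \<beta>) (s + s')"
  by (auto simp: affine_torus_map_def fun_eq_iff rotate_circle_rotate_circle algebra_simps
      option.map_comp intro!: option.map_cong)

lemma affine_torus_map_id: "affine_torus_map 1 0 0 = id"
  by (auto simp: affine_torus_map_def fun_eq_iff rotate_circle_eq_self_iff option.map_ident)

lemma affine_torus_map_inverse:
  assumes "\<alpha> \<noteq> 0"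
  shows "bij (affine_torus_map \<alpha> \<beta> s)"
    and "inv (affine_torus_map \<alpha> \<beta> s) = affine_torus_map (1 / \<alpha>) (- \<beta> / \<alpha>) (- s)"
proof -
  let ?f = "affine_torus_map \<alpha> \<beta> s" and ?g = "affine_torus_map (1 / \<alpha>) (- \<beta> / \<alpha>) (- s)"
  have "?f \<circ> ?g = id" "?g \<circ> ?f = id"
    using assms by (simp_all add: affine_torus_map_compose flip: affine_torus_map_id)
  then show "bij ?f" "inv ?f = ?g"
    by (simp_all add: o_bij inv_unique_comp)
qed

lemma affine_torus_map_funpow:
  "affine_torus_map 1 \<beta> 0 ^^ k = affine_torus_map 1 (real k * \<beta>) 0"
  "affine_torus_map \<alpha> 0 s ^^ k = affine_torus_map (\<alpha> ^ k) 0 (real k * s)"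
  by (induction k) (simp_all add: affine_torus_map_id affine_torus_map_compose algebra_simps)

lemma topspace_proj_line: "topspace (Alexandroff_compactification euclidean) = UNIV"
  by (simp flip: UNIV_option_conv)

lemma continuous_map_affine_proj_line:
  fixes \<alpha> \<beta> :: real
  assumes "\<alpha> \<noteq> 0"
  shows "continuous_map (Alexandroff_compactification euclidean) (Alexandroff_compactification euclidean)
    (map_option (\<lambda>x. \<alpha> * x + \<beta>))"
proof -
  let ?A = "\<lambda>x. \<alpha> * x + \<beta>"
  have "openin (Alexandroff_compactification euclidean) (map_option ?A -` V)"
    if "openin (Alexandroff_compactification euclidean) V" for V :: "real option set"
    using that unfolding openin_Alexandroff_compactification[of euclidean V]
  proof (elim disjE exE conjE)
    fix U assume "openin euclidean U" "V = Some ` U"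
    then have "map_option ?A -` V = Some ` (?A -` U)" "open (?A -` U)"
      by (auto intro!: open_vimage continuous_intros)
    then show ?thesis by simp
  next
    fix C assume C: "compactin euclidean C" and V: "V = insert None (Some ` (topspace euclidean - C))"
    have "?A -` C = (\<lambda>x. (x - \<beta>) / \<alpha>) ` C"
      using assms by (force simp: image_iff field_simps)
    moreover have "compact ((\<lambda>x. (x - \<beta>) / \<alpha>) ` C)"
      using C assms by (intro compact_continuous_image continuous_intros) auto
    ultimately have "compact (?A -` C)" by simp
    moreover have "map_option ?A -` V = insert None (Some ` (topspace euclidean - ?A -` C))"
    proof (rule Set.set_eqI)
      show "x \<in> map_option ?A -` V \<longleftrightarrow> x \<in> insert None (Some ` (topspace euclidean - ?A -` C))" for x
        by (cases x) (auto simp: V)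
    qed
    ultimately show ?thesis
      unfolding openin_Alexandroff_compactification
      by (intro disjI2 exI[of _ "?A -` C"]) (simp add: compact_imp_closed)
  qed
  then show ?thesis
    by (simp add: continuous_map_def vimage_def topspace_proj_line
        del: topspace_Alexandroff_compactification)
qed

lemma continuous_map_rotate_circle: "continuous_map euclidean euclidean (rotate_circle s)"
proof -
  have "open (rotate_circle s -` U)" if "open U" for U
  proof -
    have "to_circle -` (rotate_circle s -` U) = (\<lambda>t. t + s) -` (to_circle -` U)"
      by auto
    moreover have "open (to_circle -` U)"
      using that by (simp add: open_circle_def)
    then have "open ((\<lambda>t. t + s) -` (to_circle -` U))"
      by (rule open_vimage) (intro continuous_intros)
    ultimately show ?thesis by (simp add: open_circle_def)
  qed
  then show ?thesis
    by (simp add: continuous_on_open_vimage)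
qed

lemma topspace_torus_top [simp]: "topspace torus_top = UNIV"
  by (simp add: torus_top_def topspace_proj_line del: topspace_Alexandroff_compactification)

lemma continuous_map_affine_torus_map:
  assumes "\<alpha> \<noteq> 0"
  shows "continuous_map torus_top torus_top (affine_torus_map \<alpha> \<beta> s)"
  using continuous_map_affine_proj_line[OF assms] continuous_map_rotate_circle
  by (simp add: torus_top_def affine_torus_map_def map_prod_def continuous_map_prod_top)

section \<open>Charts\<close>

lemma inj_to_circle: "inj_on to_circle {c<..<c + 1}"
proof (rule inj_onI)
  fix x y assume xy: "x \<in> {c<..<c + 1}" "y \<in> {c<..<c + 1}" "to_circle x = to_circle y"
  from xy(3) obtain k where "x - y = of_int k"
    by (auto simp: to_circle_eq_iff elim: Ints_cases)
  with xy(1,2) have "- 1 < real_of_int k" "real_of_int k < 1" by auto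
  then have "k = 0" by linarith
  with \<open>x - y = of_int k\<close> show "x = y" by simp
qed

lemma circle_chart_to_circle:
  "t \<in> {c<..<c + 1} \<Longrightarrow> inv_into {c<..<c + 1} to_circle (to_circle t) = t"
  by (rule inv_into_f_f[OF inj_to_circle])

lemma inj_circle_chart: "inj_on (inv_into {c<..<c + 1} to_circle) (to_circle ` {c<..<c + 1})"
  by (rule inj_on_inv_into) simp

lemma proj_line_atlas_cases [consumes 1, case_names affine infinity]:
  assumes "(U, \<phi>) \<in> proj_line_atlas"
  obtains "U = range Some" "\<phi> = the"
    | "U = UNIV - {Some 0}" "\<phi> = (\<lambda>p. case p of None \<Rightarrow> 0 | Some x \<Rightarrow> 1 / x)"
  using assms by (auto simp: proj_line_atlas_def)

lemma inj_proj_line_chart: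
  assumes "(U, \<phi>) \<in> proj_line_atlas"
  shows "inj_on \<phi> U"
  using assms by (cases rule: proj_line_atlas_cases) (auto simp: inj_on_def split: option.splits)

lemma inv_into_proj_line_chart:
  "inv_into (range Some) the (x::real) = Some x"
  "inv_into (UNIV - {Some 0}) (\<lambda>p. case p of None \<Rightarrow> 0 | Some x \<Rightarrow> 1 / x) (u::real) =
     (if u = 0 then None else Some (1 / u))"
proof -
  show "inv_into (range Some) the x = Some x"
    by (rule inv_into_f_eq) (auto simp: inj_on_def)
  have "inj_on (\<lambda>p. case p of None \<Rightarrow> 0 | Some x \<Rightarrow> 1 / x) (UNIV - {Some (0::real)})"
    by (rule inj_proj_line_chart) (simp add: proj_line_atlas_def)
  then show "inv_into (UNIV - {Some 0}) (\<lambda>p. case p of None \<Rightarrow> 0 | Some x \<Rightarrow> 1 / x) u =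
     (if u = 0 then None else Some (1 / u))"
    by (rule inv_into_f_eq) auto
qed

text \<open>Between the charts \<open>x\<close> and \<open>1 / x\<close> of the projective line, an affine map becomes a Moebius
  map. Its denominator vanishes exactly at the points that leave the second chart; at infinity,
  this uses \<open>\<alpha> \<noteq> 0\<close>.\<close>

lemma proj_line_transition_rational:
  assumes "(U, \<phi>) \<in> proj_line_atlas" "(U', \<phi>') \<in> proj_line_atlas" "\<alpha> \<noteq> 0"
  obtains p q :: "real poly" where
    "\<And>x. x \<in> \<phi> ` U"
    "\<And>x. map_option (\<lambda>x. \<alpha> * x + \<beta>) (inv_into U \<phi> x) \<in> U' \<longleftrightarrow> poly q x \<noteq> 0"
    "\<And>x. poly q x \<noteq> 0 \<Longrightarrow>
      \<phi>' (map_option (\<lambda>x. \<alpha> * x + \<beta>) (inv_into U \<phi> x)) = poly p x / poly q x"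
proof -
  have onto: "x \<in> \<phi> ` U" for x
    using assms(1)
  proof (cases rule: proj_line_atlas_cases)
    case affine
    then show ?thesis by (auto intro!: image_eqI[of _ _ "Some x"])
  next
    case infinity
    then show ?thesis
      by (intro image_eqI[of _ _ "if x = 0 then None else Some (1 / x)"]) auto
  qed
  show thesis
    using assms(1)
  proof (cases rule: proj_line_atlas_cases)
    case 1: affine
    from assms(2) show thesis
    proof (cases rule: proj_line_atlas_cases)
      case affine
      show thesis
        by (rule that[of "[:1:]" "[:\<beta>, \<alpha>:]", OF onto])
          (auto simp: 1 affine inv_into_proj_line_chart)
    next
      case infinity
      show thesis
        by (rule that[of "[:\<beta>, \<alpha>:]" "[:1:]", OF onto])
          (auto simp: 1 infinity inv_into_proj_line_chart ac_simps)
    qed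
  next
    case 1: infinity
    from assms(2) show thesis
    proof (cases rule: proj_line_atlas_cases)
      case affine
      show thesis
        by (rule that[of "[:0, 1:]" "[:\<alpha>, \<beta>:]", OF onto])
          (auto simp: 1 affine inv_into_proj_line_chart field_simps)
    next
      case infinity
      have "\<alpha> / x + \<beta> = (\<alpha> + x * \<beta>) / x" if "x \<noteq> 0" for x
        using that by (simp add: field_simps)
      with assms(3) show thesis
        by (intro that[of "[:\<alpha>, \<beta>:]" "[:0, 1:]", OF onto])
          (auto simp: 1 infinity inv_into_proj_line_chart)
    qed
  qed
qed

lemma torus_atlas_cases:
  assumes "c \<in> torus_atlas"
  obtains U \<phi> a where "(U, \<phi>) \<in> proj_line_atlas"
    "c = (U \<times> to_circle ` {a<..<a + 1}, map_prod \<phi> (inv_into {a<..<a + 1} to_circle))"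
  using assms by (auto simp: torus_atlas_def circle_atlas_def)

lemma inj_torus_chart:
  assumes "c \<in> torus_atlas"
  shows "inj_on (snd c) (fst c)"
  using assms by (rule torus_atlas_cases)
    (simp add: map_prod_inj_on inj_proj_line_chart inj_circle_chart)

lemma inv_into_torus_chart:
  assumes "(U, \<phi>) \<in> proj_line_atlas" "x \<in> \<phi> ` U" "t \<in> {a<..<a + 1}"
  shows "inv_into (U \<times> to_circle ` {a<..<a + 1}) (map_prod \<phi> (inv_into {a<..<a + 1} to_circle)) (x, t)
    = (inv_into U \<phi> x, to_circle t)"
  using assms
  by (intro inv_into_f_eq map_prod_inj_on inj_proj_line_chart inj_circle_chart)
    (auto simp: circle_chart_to_circle f_inv_into_f inv_into_into)

text \<open>The lift \<open>t + s + k\<close> of the rotation to the second circle chart involves an integer \<open>k\<close> that is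
  locally constant. It is constant jointly in the angle and in the point, which serves twice: the
  slice at a fixed angle gives the smoothness of a single map, and the joint statement gives the
  continuous dependence on the angle.\<close>

lemma affine_torus_map_in_charts:
  assumes c: "c \<in> torus_atlas" and d: "d \<in> torus_atlas" and \<alpha>: "\<alpha> \<noteq> 0"
    and z: "z \<in> fst c" "affine_torus_map \<alpha> \<beta> s\<^sub>0 z \<in> fst d"
  obtains p q :: "real poly" and k :: real and W where
    "open W" "(s\<^sub>0, snd c z) \<in> W"
    "\<And>s y. (s, y) \<in> W \<Longrightarrow>
      poly q (fst y) \<noteq> 0 \<and> y \<in> snd c ` (fst c \<inter> affine_torus_map \<alpha> \<beta> s -` fst d) \<and>
      in_charts c d (affine_torus_map \<alpha> \<beta> s) y = (poly p (fst y) / poly q (fst y), snd y + s + k)"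
proof -
  from c obtain U \<phi> a where U: "(U, \<phi>) \<in> proj_line_atlas"
    and c_eq: "c = (U \<times> to_circle ` {a<..<a + 1}, map_prod \<phi> (inv_into {a<..<a + 1} to_circle))"
    by (rule torus_atlas_cases)
  from d obtain U' \<phi>' b where U': "(U', \<phi>') \<in> proj_line_atlas"
    and d_eq: "d = (U' \<times> to_circle ` {b<..<b + 1}, map_prod \<phi>' (inv_into {b<..<b + 1} to_circle))"
    by (rule torus_atlas_cases)
  from U U' \<alpha> obtain p q :: "real poly" where onto: "\<And>x. x \<in> \<phi> ` U"
    and dom: "\<And>x. map_option (\<lambda>x. \<alpha> * x + \<beta>) (inv_into U \<phi> x) \<in> U' \<longleftrightarrow> poly q x \<noteq> 0"
    and val: "\<And>x. poly q x \<noteq> 0 \<Longrightarrow>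
      \<phi>' (map_option (\<lambda>x. \<alpha> * x + \<beta>) (inv_into U \<phi> x)) = poly p x / poly q x"
    by (rule proj_line_transition_rational[where \<beta> = \<beta>]) (rule that)
  from z(1) obtain w t where w: "w \<in> U" and t: "t \<in> {a<..<a + 1}" and z_eq: "z = (w, to_circle t)"
    by (auto simp: c_eq)
  from z(2) obtain t' where w': "map_option (\<lambda>x. \<alpha> * x + \<beta>) w \<in> U'"
    and t': "t' \<in> {b<..<b + 1}" "to_circle (t + s\<^sub>0) = to_circle t'"
    by (auto simp: d_eq z_eq affine_torus_map_def)
  define k where "k = t' - (t + s\<^sub>0)"
  have k: "k \<in> \<int>"
    using t'(2) unfolding k_def to_circle_eq_iff by (metis Ints_minus minus_diff_eq)
  define W where "W = {sy :: real \<times> real \<times> real. poly q (fst (snd sy)) \<noteq> 0 \<and>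
    a < snd (snd sy) \<and> snd (snd sy) < a + 1 \<and>
    b < snd (snd sy) + fst sy + k \<and> snd (snd sy) + fst sy + k < b + 1}"
  show thesis
  proof
    show "open W"
      unfolding W_def
      by (intro open_Collect_conj open_Collect_less open_Collect_neq continuous_intros)
    have "inv_into U \<phi> (\<phi> w) = w"
      using inj_proj_line_chart[OF U] w by simp
    with dom[of "\<phi> w"] w' have "poly q (\<phi> w) \<noteq> 0"
      by simp
    then show "(s\<^sub>0, snd c z) \<in> W"
      using t t'(1) by (simp add: W_def c_eq z_eq circle_chart_to_circle k_def)
  next
    fix s y assume "(s, y) \<in> W"
    then obtain x r where y: "y = (x, r)" and q: "poly q x \<noteq> 0" and r: "r \<in> {a<..<a + 1}"
      and r': "r + s + k \<in> {b<..<b + 1}"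
      by (cases y) (auto simp: W_def)
    have shift: "to_circle (r + s) = to_circle (r + s + k)"
      using k by (simp add: to_circle_eq_iff)
    have inv: "inv_into (fst c) (snd c) y = (inv_into U \<phi> x, to_circle r)"
      using inv_into_torus_chart[OF U onto r] by (simp add: c_eq y)
    have dom': "affine_torus_map \<alpha> \<beta> s (inv_into U \<phi> x, to_circle r) \<in> fst d"
      using q r' by (auto simp: d_eq affine_torus_map_def dom shift)
    have "y = snd c (inv_into U \<phi> x, to_circle r)"
      using onto r by (simp add: c_eq y f_inv_into_f circle_chart_to_circle)
    moreover have "(inv_into U \<phi> x, to_circle r) \<in> fst c"
      using onto r by (auto simp: c_eq inv_into_into)
    ultimately have "y \<in> snd c ` (fst c \<inter> affine_torus_map \<alpha> \<beta> s -` fst d)"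
      using dom' by blast
    moreover have "in_charts c d (affine_torus_map \<alpha> \<beta> s) y = (poly p x / poly q x, r + s + k)"
      using q r' by (simp add: in_charts_def inv d_eq affine_torus_map_def val shift circle_chart_to_circle)
    ultimately show "poly q (fst y) \<noteq> 0 \<and>
        y \<in> snd c ` (fst c \<inter> affine_torus_map \<alpha> \<beta> s -` fst d) \<and>
        in_charts c d (affine_torus_map \<alpha> \<beta> s) y = (poly p (fst y) / poly q (fst y), snd y + s + k)"
      using q by (simp add: y)
  qed
qed

lemma torus_diffeo_affine_torus_map:
  assumes "\<alpha> \<noteq> 0"
  shows "torus_diffeo (affine_torus_map \<alpha> \<beta> s)"
proof -
  have smooth: "smooth_torus_map (affine_torus_map \<alpha> \<beta> s)" if \<alpha>: "\<alpha> \<noteq> 0" for \<alpha> \<beta> s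
    unfolding smooth_torus_map_def
  proof (intro conjI ballI continuous_map_affine_torus_map \<alpha>)
    fix c d assume c: "c \<in> torus_atlas" and d: "d \<in> torus_atlas"
    let ?f = "affine_torus_map \<alpha> \<beta> s"
    show "smooth_on (snd c ` (fst c \<inter> ?f -` fst d)) (in_charts c d ?f)"
      unfolding smooth_on_def
    proof (intro allI ballI)
      fix vs y assume "y \<in> snd c ` (fst c \<inter> ?f -` fst d)"
      then obtain z where z: "z \<in> fst c" "?f z \<in> fst d" and y: "y = snd c z"
        by auto
      from c d \<alpha> z obtain p q :: "real poly" and k W
        where W: "open W" "(s, snd c z) \<in> W" and loc: "\<And>s y. (s, y) \<in> W \<Longrightarrow>
          poly q (fst y) \<noteq> 0 \<and> y \<in> snd c ` (fst c \<inter> affine_torus_map \<alpha> \<beta> s -` fst d) \<and>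
          in_charts c d (affine_torus_map \<alpha> \<beta> s) y = (poly p (fst y) / poly q (fst y), snd y + s + k)"
        by (rule affine_torus_map_in_charts[where \<beta> = \<beta>]) (rule that)
      have "open (Pair s -` W)"
        using W(1) by (intro open_vimage continuous_intros)
      then have "smooth_on (Pair s -` W) (in_charts c d ?f)"
        by (rule smooth_on_rational_times_translation[of _ q _ p "s + k"])
          (use loc in \<open>auto simp: add.assoc\<close>)
      then show "iter_deriv vs (in_charts c d ?f) differentiable (at y)"
        using W(2) by (simp add: smooth_on_def y)
    qed
  qed
  show ?thesis
    using assms smooth by (simp add: torus_diffeo_def affine_torus_map_inverse)
qed

section \<open>Continuity in the rotation angle\<close>

text \<open>Continuity of the charts makes the image of a compact set under a chart a compact subset of the
  plane, to which the tube lemma applies.\<close>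

lemma continuous_map_proj_line_chart:
  assumes "(U, \<phi>) \<in> proj_line_atlas"
  shows "continuous_map (subtopology (Alexandroff_compactification euclidean) U) euclidean \<phi>"
proof -
  let ?X = "Alexandroff_compactification (euclidean :: real topology)"
  have "openin ?X (U \<inter> \<phi> -` V)" if V: "open V" for V
    using assms
  proof (cases rule: proj_line_atlas_cases)
    case affine
    then have "U \<inter> \<phi> -` V = Some ` V" by auto
    with V show ?thesis by simp
  next
    case infinity
    define W where "W = {x::real. x \<noteq> 0 \<and> 1 / x \<in> V}"
    have "W = (- {0}) \<inter> (\<lambda>x. 1 / x) -` V"
      by (auto simp: W_def)
    also have "open \<dots>"
      using V by (intro continuous_open_preimage continuous_intros) auto
    finally have W: "open W" .
    show ?thesis
    proof (cases "0 \<in> V")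
      case True
      then have eq: "U \<inter> \<phi> -` V = insert None (Some ` (topspace euclidean - (- W)))"
        by (auto simp: infinity W_def split: option.splits)
      from V True obtain e where e: "e > 0" "ball 0 e \<subseteq> V"
        by (auto simp: open_contains_ball)
      have "\<bar>x\<bar> \<le> 1 / e" if "x \<in> - W" for x
      proof (rule ccontr)
        assume x: "\<not> \<bar>x\<bar> \<le> 1 / e"
        from e(1) have "0 < 1 / e" by simp
        with x have "x \<noteq> 0" by auto
        have "1 / \<bar>x\<bar> < e"
          using x e(1) \<open>x \<noteq> 0\<close> by (simp add: not_le pos_divide_less_eq mult.commute)
        then have "1 / x \<in> ball 0 e" by simp
        with e(2) \<open>x \<noteq> 0\<close> that show False
          unfolding W_def by blast
      qed
      then have "bounded (- W)"
        by (auto simp: bounded_iff)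
      with W have "compact (- W)"
        by (simp add: compact_eq_bounded_closed closed_Compl)
      with W show ?thesis
        unfolding openin_Alexandroff_compactification eq by (intro disjI2 exI[of _ "- W"]) (simp add: closed_Compl)
    next
      case False
      then have "U \<inter> \<phi> -` V = Some ` W"
        by (auto simp: infinity W_def split: option.splits)
      with W show ?thesis by simp
    qed
  qed
  then have "openin (subtopology ?X U) (U \<inter> \<phi> -` V)" if "open V" for V
    using that by (intro subset_openin_subtopology) simp_all
  moreover have "{p \<in> topspace (subtopology ?X U). \<phi> p \<in> V} = U \<inter> \<phi> -` V" for V
    unfolding topspace_subtopology topspace_proj_line by blast
  ultimately show ?thesis
    unfolding continuous_map by (simp del: topspace_Alexandroff_compactification)
qed

text \<open>The saturation of an open set is the union of its integer translates.\<close>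

lemma open_image_to_circle:
  assumes "open U"
  shows "open (to_circle ` U)"
proof -
  have "to_circle -` (to_circle ` U) = (\<Union>k\<in>\<int>. (\<lambda>t. t + k) -` U)"
  proof (intro equalityI subsetI)
    fix t assume "t \<in> to_circle -` (to_circle ` U)"
    then obtain u where "u \<in> U" "t - u \<in> \<int>" by (auto simp: to_circle_eq_iff)
    then show "t \<in> (\<Union>k\<in>\<int>. (\<lambda>t. t + k) -` U)"
      using Ints_minus[of "t - u"] by (intro UN_I[of "u - t"]) simp_all
  next
    fix t assume "t \<in> (\<Union>k\<in>\<int>. (\<lambda>t. t + k) -` U)"
    then obtain k where k: "k \<in> \<int>" "t + k \<in> U" by auto
    then have "to_circle t = to_circle (t + k)" by (simp add: to_circle_eq_iff)
    with k show "t \<in> to_circle -` (to_circle ` U)" by auto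
  qed
  moreover have "open (\<Union>k\<in>\<int>. (\<lambda>t. t + k) -` U)"
    by (intro open_UN ballI open_vimage assms continuous_intros)
  ultimately show ?thesis by (simp add: open_circle_def)
qed

lemma continuous_on_circle_chart:
  "continuous_on (to_circle ` {c<..<c + 1}) (inv_into {c<..<c + 1} to_circle)"
proof -
  have "open (to_circle ` {c<..<c + 1})"
    by (simp add: open_image_to_circle)
  moreover have "inv_into {c<..<c + 1} to_circle -` V \<inter> to_circle ` {c<..<c + 1} =
      to_circle ` (V \<inter> {c<..<c + 1})" for V
    using circle_chart_to_circle[of _ c] by auto
  ultimately show ?thesis
    by (simp add: continuous_on_open_vimage open_image_to_circle open_Int)
qed

lemma continuous_map_torus_chart:
  assumes "c \<in> torus_atlas"
  shows "continuous_map (subtopology torus_top (fst c)) euclidean (snd c)"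
  using assms
proof (rule torus_atlas_cases)
  fix U \<phi> a assume U: "(U, \<phi>) \<in> proj_line_atlas"
    and c: "c = (U \<times> to_circle ` {a<..<a + 1}, map_prod \<phi> (inv_into {a<..<a + 1} to_circle))"
  have "continuous_map
      (prod_topology (subtopology (Alexandroff_compactification euclidean) U)
         (subtopology euclidean (to_circle ` {a<..<a + 1})))
      (prod_topology euclidean euclidean) (map_prod \<phi> (inv_into {a<..<a + 1} to_circle))"
    using continuous_map_proj_line_chart[OF U] continuous_on_circle_chart
    by (simp only: map_prod_def continuous_map_prod_top continuous_map_iff_continuous) simp
  then show ?thesis
    by (simp add: c torus_top_def subtopology_Times)
qed

lemma eventually_all_compact:
  assumes "compact K"
    and "\<And>y. y \<in> K \<Longrightarrow> \<forall>\<^sub>F z in nhds (x, y). P (fst z) (snd z)"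
  shows "\<forall>\<^sub>F x' in nhds x. \<forall>y\<in>K. P x' y"
proof -
  have "{x} \<times> K \<subseteq> interior {z. P (fst z) (snd z)}"
    using assms(2) by (auto simp: interior_def eventually_nhds subset_eq)
  from Elementary_Topology.tube_lemma[OF assms(1) open_interior this] obtain X
    where X: "x \<in> X" "open X" "X \<times> K \<subseteq> interior {z. P (fst z) (snd z)}"
    by blast
  have "P x' y" if "x' \<in> X" "y \<in> K" for x' y
  proof -
    have "(x', y) \<in> {z. P (fst z) (snd z)}"
      using that X(3) interior_subset by blast
    then show ?thesis by simp
  qed
  with X show ?thesis
    unfolding eventually_nhds by blast
qed

text \<open>For \<open>N\<close> a subbasic neighbourhood given by a compact set \<open>K\<close>, the condition that the map with
  angle \<open>s\<close> lies in \<open>N\<close> has three ingredients. That \<open>K\<close> goes to the domain of the second chart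
  and that the values are \<open>\<epsilon>\<close>-close are open conditions on the angle and the point, hence
  open in the angle by compactness of \<open>K\<close>. The derivatives of positive order are locally
  independent of the angle.\<close>

lemma continuous_map_rotation_angle:
  assumes \<alpha>: "\<alpha> \<noteq> 0"
  shows "continuous_map euclidean smooth_topology (affine_torus_map \<alpha> \<beta>)"
  unfolding smooth_topology_def
proof (rule continuous_on_generated_topo)
  have smooth: "smooth_torus_map (affine_torus_map \<alpha> \<beta> s)" for s
    using torus_diffeo_affine_torus_map[OF \<alpha>] by (simp add: torus_diffeo_def)
  have "\<Union> smooth_subbasis = Collect smooth_torus_map"
    using topspace_smooth_topology by (simp only: smooth_topology_def topology_generated_by_topspace)
  with smooth show "affine_torus_map \<alpha> \<beta> ` topspace euclidean \<subseteq> \<Union> smooth_subbasis"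
    by auto
  fix N assume "N \<in> smooth_subbasis"
  then obtain f c d K r \<epsilon> where N: "N = smooth_nbhd f c d K r \<epsilon>" and f: "smooth_torus_map f"
    and c: "c \<in> torus_atlas" and d: "d \<in> torus_atlas" and K: "compactin torus_top K" "K \<subseteq> fst c"
    and fK: "f ` K \<subseteq> fst d" and "\<epsilon> > 0"
    unfolding smooth_subbasis_def by blast
  let ?h = "affine_torus_map \<alpha> \<beta>"
  have "compact (snd c ` K)"
    using image_compactin[OF compact_imp_compactin_subtopology[OF K] continuous_map_torus_chart[OF c]]
    by simp
  have nearby: "\<forall>\<^sub>F s in nhds s\<^sub>0. ?h s \<in> N" if s0: "?h s\<^sub>0 \<in> N" for s\<^sub>0
  proof -
    from s0 have s0_close: "\<forall>vs. set vs \<subseteq> Basis \<and> length vs \<le> r \<longrightarrow> (\<forall>y\<in>snd c ` K.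
        norm (iter_deriv vs (in_charts c d (?h s\<^sub>0)) y - iter_deriv vs (in_charts c d f) y) < \<epsilon>)"
      unfolding N smooth_nbhd_def mem_Collect_eq by (elim conjE)
    from s0 have s0_dom: "?h s\<^sub>0 ` K \<subseteq> fst d"
      unfolding N smooth_nbhd_def mem_Collect_eq by (elim conjE)
    \<comment> \<open>The derivatives are compared with those at \<open>s\<^sub>0\<close>, which are within
      \<open>\<epsilon>\<close> of those of \<open>f\<close> on the image of \<open>K\<close>.\<close>
    define P where "P s y \<longleftrightarrow> y \<in> snd c ` (fst c \<inter> ?h s -` fst d) \<and>
        norm (in_charts c d (?h s) y - in_charts c d f y) < \<epsilon> \<and>
        (\<forall>v vs. iter_deriv (v # vs) (in_charts c d (?h s)) y =
                iter_deriv (v # vs) (in_charts c d (?h s\<^sub>0)) y)" for s y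
    have "\<forall>\<^sub>F z in nhds (s\<^sub>0, y). P (fst z) (snd z)" if "y \<in> snd c ` K" for y
    proof -
      from that obtain z where z: "z \<in> K" "y = snd c z" by blast
      with K(2) s0_dom fK have z': "z \<in> fst c" "?h s\<^sub>0 z \<in> fst d" "f z \<in> fst d"
        by blast+
      from c d \<alpha> z'(1,2) obtain p q :: "real poly" and k W
        where W: "open W" "(s\<^sub>0, snd c z) \<in> W" and loc: "\<And>s y. (s, y) \<in> W \<Longrightarrow>
          poly q (fst y) \<noteq> 0 \<and> y \<in> snd c ` (fst c \<inter> ?h s -` fst d) \<and>
          in_charts c d (?h s) y = (poly p (fst y) / poly q (fst y), snd y + s + k)"
        by (rule affine_torus_map_in_charts[where \<beta> = \<beta>]) (rule that)
      \<comment> \<open>The chart expression as a continuous function of angle and point together.\<close>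
      define g where "g w = (poly p (fst (snd w)) / poly q (fst (snd w)), snd (snd w) + fst w + k)"
        for w :: "real \<times> real \<times> real"
      define G where "G w = norm (g w - in_charts c d f (snd w))" for w
      have near: "\<forall>\<^sub>F w in nhds (s\<^sub>0, y). w \<in> W"
        using W z by (auto simp: eventually_nhds)
      have "open ((\<lambda>w. (s\<^sub>0, snd w)) -` W)"
        by (intro open_vimage W continuous_intros)
      then have near': "\<forall>\<^sub>F w in nhds (s\<^sub>0, y). (s\<^sub>0, snd w) \<in> W"
        unfolding eventually_nhds using W z by (intro exI[of _ "(\<lambda>w. (s\<^sub>0, snd w)) -` W"]) auto
      have "smooth_on (snd c ` (fst c \<inter> f -` fst d)) (in_charts c d f)"
        using f c d by (simp add: smooth_torus_map_def)
      then have "iter_deriv [] (in_charts c d f) differentiable (at y)"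
        unfolding smooth_on_def using z(2) z' by blast
      then have "isCont (in_charts c d f) y"
        by (simp add: differentiable_imp_continuous_within)
      then have "isCont (\<lambda>w. in_charts c d f (snd w)) (s\<^sub>0, y)"
        using isCont_o2[OF isCont_snd[OF continuous_ident],
            where g = "in_charts c d f" and a = "(s\<^sub>0, y)"]
        by simp
      moreover have "isCont g (s\<^sub>0, y)"
        using loc[OF W(2)] unfolding g_def by (intro continuous_intros) (simp_all add: z)
      ultimately have "isCont G (s\<^sub>0, y)"
        unfolding G_def by (intro continuous_intros)
      then have G_lim: "(G \<longlongrightarrow> G (s\<^sub>0, y)) (nhds (s\<^sub>0, y))"
        by (simp only: isCont_def tendsto_at_iff_tendsto_nhds)
      have "G (s\<^sub>0, y) = norm (in_charts c d (?h s\<^sub>0) y - in_charts c d f y)"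
        using loc[OF W(2)] by (simp add: G_def g_def z)
      also have "\<dots> < \<epsilon>"
        using spec[OF s0_close, of "[]"] z by simp
      finally have "\<forall>\<^sub>F w in nhds (s\<^sub>0, y). G w < \<epsilon>"
        by (rule order_tendstoD(2)[OF G_lim])
      then show ?thesis
        using near near'
      proof eventually_elim
        fix w assume w: "G w < \<epsilon>" "w \<in> W" "(s\<^sub>0, snd w) \<in> W"
        obtain s x where sx: "w = (s, x)" by (cases w)
        have "open (Pair s -` W)" "open (Pair s\<^sub>0 -` W)"
          by (intro open_vimage W continuous_intros)+
        from this[THEN eventually_nhds_in_open, of x]
        have "\<forall>\<^sub>F x' in nhds x. x' \<in> Pair s -` W" "\<forall>\<^sub>F x' in nhds x. x' \<in> Pair s\<^sub>0 -` W"
          using w(2,3) by (simp_all only: sx vimage_eq snd_conv)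
        then have "\<forall>\<^sub>F x' in nhds x.
            in_charts c d (?h s) x' = in_charts c d (?h s\<^sub>0) x' + (0, s - s\<^sub>0)"
          by eventually_elim (use loc in simp)
        from iter_deriv_eventually_translate[OF this] w loc[of s x]
        show "P (fst w) (snd w)"
          by (simp add: P_def sx G_def g_def)
      qed
    qed
    from eventually_all_compact[OF \<open>compact (snd c ` K)\<close> this]
    show ?thesis
    proof (rule eventually_mono)
      fix s assume P: "\<forall>y\<in>snd c ` K. P s y"
      show "?h s \<in> N"
        unfolding N smooth_nbhd_def mem_Collect_eq
      proof (intro conjI smooth allI impI ballI)
        show "?h s ` K \<subseteq> fst d"
        proof (intro image_subsetI)
          fix z assume z: "z \<in> K"
          with P have "snd c z \<in> snd c ` (fst c \<inter> ?h s -` fst d)"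
            by (simp add: P_def)
          then obtain z' where z': "z' \<in> fst c" "?h s z' \<in> fst d" "snd c z = snd c z'"
            by blast
          with inj_onD[OF inj_torus_chart[OF c] z'(3)] z K(2) show "?h s z \<in> fst d"
            by blast
        qed
        fix vs :: "(real \<times> real) list" and y
        assume vs: "set vs \<subseteq> Basis \<and> length vs \<le> r" and y: "y \<in> snd c ` K"
        show "norm (iter_deriv vs (in_charts c d (?h s)) y - iter_deriv vs (in_charts c d f) y) < \<epsilon>"
        proof (cases vs)
          case Nil
          from P y have "P s y" by blast
          then show ?thesis by (simp add: P_def Nil)
        next
          case (Cons v vs')
          have "norm (iter_deriv vs (in_charts c d (?h s\<^sub>0)) y - iter_deriv vs (in_charts c d f) y) < \<epsilon>"
            using s0_close vs y by blast
          moreover have "iter_deriv vs (in_charts c d (?h s)) y = iter_deriv vs (in_charts c d (?h s\<^sub>0)) y"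
            using bspec[OF P y] unfolding Cons P_def by blast
          ultimately show ?thesis by simp
        qed
      qed
    qed
  qed
  have "open (?h -` N)"
  proof (subst open_subopen, intro ballI)
    fix s assume "s \<in> ?h -` N"
    then have "\<forall>\<^sub>F s' in nhds s. ?h s' \<in> N"
      using nearby by simp
    then show "\<exists>T. open T \<and> s \<in> T \<and> T \<subseteq> ?h -` N"
      unfolding eventually_nhds by blast
  qed
  then show "openin euclidean (?h -` N \<inter> topspace euclidean)"
    by simp
qed

section \<open>Presented groups and Baumslag-Solitar relations\<close>

text \<open>The action on \<open>'x\<close> of the free group on \<open>'g\<close>, for bijections \<open>\<sigma> g\<close>.\<close>

primrec eval_word :: "('g \<Rightarrow> 'x \<Rightarrow> 'x) \<Rightarrow> 'g word \<Rightarrow> 'x \<Rightarrow> 'x" where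
  "eval_word \<sigma> [] = id"
| "eval_word \<sigma> (l # u) =
     (if snd l then \<sigma> (fst l) else inv (\<sigma> (fst l))) \<circ> eval_word \<sigma> u"

lemma eval_word_append: "eval_word \<sigma> (u @ v) = eval_word \<sigma> u \<circ> eval_word \<sigma> v"
  by (induction u) (simp_all add: comp_assoc)

lemma eval_word_cong:
  assumes "word_cong R u v" and bij: "\<And>g. bij (\<sigma> g)"
    and rel: "\<And>u v. (u, v) \<in> R \<Longrightarrow> eval_word \<sigma> u = eval_word \<sigma> v"
  shows "eval_word \<sigma> u = eval_word \<sigma> v"
  using assms(1)
proof induction
  case (word_cong_cancel x e)
  then show ?case
    using bij[of x] by (auto simp: bij_is_inj bij_is_surj fun_eq_iff surj_f_inv_f)
qed (auto simp: eval_word_append rel)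

text \<open>The universal property of the presented group, for its actions by bijections.\<close>

lemma presented_group_action:
  assumes "\<And>g. bij (\<sigma> g)"
    and "\<And>u v. (u, v) \<in> R \<Longrightarrow> eval_word \<sigma> u = eval_word \<sigma> v"
  obtains \<rho> where "\<And>u. \<rho> (word_class R u) = eval_word \<sigma> u"
proof
  define \<rho> where "\<rho> X = eval_word \<sigma> (SOME u. u \<in> X)" for X
  fix u
  have "(SOME v. v \<in> word_class R u) \<in> word_class R u"
    by (rule someI[of _ u]) (simp add: word_class_def word_cong_refl)
  then have "word_cong R u (SOME v. v \<in> word_class R u)"
    by (simp add: word_class_def)
  from eval_word_cong[OF this, of \<sigma>] show "\<rho> (word_class R u) = eval_word \<sigma> u"
    using assms by (simp add: \<rho>_def)
qed

lemma (in group) Baumslag_Solitar_pow_commute: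
  fixes n j k :: nat
  assumes A: "A \<in> carrier G" and B: "B \<in> carrier G" and AB: "A \<otimes> B = B [^] n \<otimes> A"
  shows "A [^] j \<otimes> B [^] k = B [^] (n ^ j * k) \<otimes> A [^] j"
proof -
  have 1: "A \<otimes> B [^] k = B [^] (n * k) \<otimes> A" for k :: nat
  proof (induction k)
    case (Suc k)
    have "A \<otimes> B [^] Suc k = (A \<otimes> B [^] k) \<otimes> B"
      using A B by (simp add: m_assoc)
    also have "\<dots> = B [^] (n * k) \<otimes> (A \<otimes> B)"
      using A B by (simp add: Suc m_assoc)
    also have "\<dots> = B [^] (n * k + n) \<otimes> A"
      using A B by (simp add: AB nat_pow_mult flip: m_assoc)
    finally show ?case by (simp add: add.commute)
  qed (use A B in simp)
  show ?thesis
  proof (induction j arbitrary: k)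
    case (Suc j)
    have "A [^] Suc j \<otimes> B [^] k = A [^] j \<otimes> (A \<otimes> B [^] k)"
      using A B by (simp add: m_assoc)
    also have "\<dots> = (A [^] j \<otimes> B [^] (n * k)) \<otimes> A"
      using A B by (simp add: 1 m_assoc)
    also have "\<dots> = B [^] (n ^ j * (n * k)) \<otimes> (A [^] j \<otimes> A)"
      using A B by (simp add: Suc m_assoc)
    finally show ?case by (simp add: ac_simps)
  qed (use A B in simp)
qed

definition BS1_a :: "nat \<Rightarrow> bs_gen word set" where
  "BS1_a n = word_class (BS1_rel n) [(gen_a, True)]"

definition BS1_b :: "nat \<Rightarrow> bs_gen word set" where
  "BS1_b n = word_class (BS1_rel n) [(gen_b, True)]"

lemma BS1_carrier: "carrier (BS1 n) = range (word_class (BS1_rel n))"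
  and BS1_one: "\<one>\<^bsub>BS1 n\<^esub> = word_class (BS1_rel n) []"
  and BS1_mult: "word_class (BS1_rel n) u \<otimes>\<^bsub>BS1 n\<^esub> word_class (BS1_rel n) v
    = word_class (BS1_rel n) (u @ v)"
  and group_BS1: "group (BS1 n)"
  by (simp_all add: BS1_def group_presented_group mult_word_class)
     (simp_all add: presented_group_def)

lemma BS1_inverse_letter:
  "word_class (BS1_rel n) [(x, False)] = m_inv (BS1 n) (word_class (BS1_rel n) [(x, True)])"
proof -
  interpret group "BS1 n" by (rule group_BS1)
  have "word_class (BS1_rel n) [(x, False)] \<otimes>\<^bsub>BS1 n\<^esub> word_class (BS1_rel n) [(x, True)]
      = \<one>\<^bsub>BS1 n\<^esub>"
    using word_cong_cancel[of "BS1_rel n" x False]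
    by (simp add: BS1_mult BS1_one word_class_eq_iff)
  then show ?thesis
    by (intro inv_equality[symmetric]) (auto simp: BS1_carrier)
qed

lemma BS1_b_pow: "BS1_b n [^]\<^bsub>BS1 n\<^esub> (k::nat) = word_class (BS1_rel n) (replicate k (gen_b, True))"
proof -
  interpret group "BS1 n" by (rule group_BS1)
  show ?thesis
    by (induction k) (simp_all add: BS1_one BS1_b_def BS1_mult replicate_append_same)
qed

lemma BS1_relation: "BS1_a n \<otimes>\<^bsub>BS1 n\<^esub> BS1_b n = BS1_b n [^]\<^bsub>BS1 n\<^esub> n \<otimes>\<^bsub>BS1 n\<^esub> BS1_a n"
proof -
  interpret group "BS1 n" by (rule group_BS1)
  have car: "BS1_a n \<in> carrier (BS1 n)" "BS1_b n \<in> carrier (BS1 n)"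
    by (simp_all add: BS1_a_def BS1_b_def BS1_carrier)
  have "BS1_a n \<otimes>\<^bsub>BS1 n\<^esub> BS1_b n \<otimes>\<^bsub>BS1 n\<^esub> m_inv (BS1 n) (BS1_a n) =
      word_class (BS1_rel n) [(gen_a, True), (gen_b, True), (gen_a, False)]"
    by (simp add: BS1_a_def BS1_b_def BS1_mult flip: BS1_inverse_letter)
  also have "\<dots> = BS1_b n [^]\<^bsub>BS1 n\<^esub> n"
    unfolding BS1_b_pow word_class_eq_iff by (rule word_cong_rel) (simp add: BS1_rel_def)
  finally show ?thesis
    using car by (metis inv_solve_right' m_closed nat_pow_closed inv_solve_right)
qed

text \<open>A substitute for the normal form \<open>a\<^sup>-\<^sup>i b\<^sup>k a\<^sup>j\<close> that has no negative exponents, so that both sides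
  can be evaluated as iterates of maps. The induction appends letters on the right. A positive
  letter \<open>b\<close> moves to the left through \<open>a\<^sup>j b = b\<^sup>m a\<^sup>j\<close> with \<open>m = n\<^sup>j\<close>; a negative
  letter is absorbed after multiplying the equation on the left by \<open>a\<close> or by \<open>b\<^sup>m\<close>.\<close>

lemma BS1_positive_form:
  assumes "X \<in> carrier (BS1 n)"
  shows "\<exists>(p::nat) (i::nat) (q::nat) (j::nat). BS1_b n [^]\<^bsub>BS1 n\<^esub> p \<otimes>\<^bsub>BS1 n\<^esub> BS1_a n [^]\<^bsub>BS1 n\<^esub> i \<otimes>\<^bsub>BS1 n\<^esub> X
    = BS1_b n [^]\<^bsub>BS1 n\<^esub> q \<otimes>\<^bsub>BS1 n\<^esub> BS1_a n [^]\<^bsub>BS1 n\<^esub> j"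
proof -
  interpret group "BS1 n" by (rule group_BS1)
  let ?G = "BS1 n" and ?A = "BS1_a n" and ?B = "BS1_b n"
  have A: "?A \<in> carrier ?G" and B: "?B \<in> carrier ?G"
    by (simp_all add: BS1_a_def BS1_b_def BS1_carrier)
  note comm = Baumslag_Solitar_pow_commute[OF A B BS1_relation]
  have comm1: "?A [^]\<^bsub>?G\<^esub> j \<otimes>\<^bsub>?G\<^esub> ?B = ?B [^]\<^bsub>?G\<^esub> (n ^ j) \<otimes>\<^bsub>?G\<^esub> ?A [^]\<^bsub>?G\<^esub> j" for j
    using comm[of j 1] B by simp
  have comm1': "?A \<otimes>\<^bsub>?G\<^esub> ?B [^]\<^bsub>?G\<^esub> k = ?B [^]\<^bsub>?G\<^esub> (n * k) \<otimes>\<^bsub>?G\<^esub> ?A" for k :: nat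
    using comm[of 1 k] A by simp
  from assms obtain w where X: "X = word_class (BS1_rel n) w"
    by (auto simp: BS1_carrier)
  show ?thesis
    unfolding X
  proof (induction w rule: rev_induct)
    case Nil
    show ?case
      using A B by (intro exI[of _ 0]) (simp flip: BS1_one)
  next
    case (snoc l w)
    let ?Y = "word_class (BS1_rel n) w"
    have Y: "?Y \<in> carrier ?G" by (simp add: BS1_carrier)
    obtain x e where l: "l = (x, e)" by (cases l)
    from snoc.IH obtain p i q j :: nat
      where IH: "?B [^]\<^bsub>?G\<^esub> p \<otimes>\<^bsub>?G\<^esub> ?A [^]\<^bsub>?G\<^esub> i \<otimes>\<^bsub>?G\<^esub> ?Y = ?B [^]\<^bsub>?G\<^esub> q \<otimes>\<^bsub>?G\<^esub> ?A [^]\<^bsub>?G\<^esub> j"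
      by blast
    have snoc_eq: "word_class (BS1_rel n) (w @ [l]) = ?Y \<otimes>\<^bsub>?G\<^esub> word_class (BS1_rel n) [l]"
      by (simp add: BS1_mult)
    consider (a) "l = (gen_a, True)" | (a') "l = (gen_a, False)"
      | (b) "l = (gen_b, True)" | (b') "l = (gen_b, False)"
      using l by (cases x; cases e) auto
    then show ?case
    proof cases
      case a
      have L: "word_class (BS1_rel n) [l] = ?A" by (simp add: a BS1_a_def)
      have "?B [^]\<^bsub>?G\<^esub> p \<otimes>\<^bsub>?G\<^esub> ?A [^]\<^bsub>?G\<^esub> i \<otimes>\<^bsub>?G\<^esub> (?Y \<otimes>\<^bsub>?G\<^esub> ?A) = ?B [^]\<^bsub>?G\<^esub> q \<otimes>\<^bsub>?G\<^esub> ?A [^]\<^bsub>?G\<^esub> Suc j"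
        using A B Y IH by (simp flip: m_assoc)
      then show ?thesis
        unfolding snoc_eq L by blast
    next
      case a'
      have L: "word_class (BS1_rel n) [l] = m_inv ?G ?A"
        by (simp add: a' BS1_a_def BS1_inverse_letter)
      have A1: "?B [^]\<^bsub>?G\<^esub> (n * p) \<otimes>\<^bsub>?G\<^esub> ?A [^]\<^bsub>?G\<^esub> Suc i =
          ?A \<otimes>\<^bsub>?G\<^esub> (?B [^]\<^bsub>?G\<^esub> p \<otimes>\<^bsub>?G\<^esub> ?A [^]\<^bsub>?G\<^esub> i)"
        unfolding nat_pow_Suc2[OF A] using A B by (simp add: comm1' flip: m_assoc)
      have "?B [^]\<^bsub>?G\<^esub> (n * p) \<otimes>\<^bsub>?G\<^esub> ?A [^]\<^bsub>?G\<^esub> Suc i \<otimes>\<^bsub>?G\<^esub> (?Y \<otimes>\<^bsub>?G\<^esub> m_inv ?G ?A)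
        = ?A \<otimes>\<^bsub>?G\<^esub> (?B [^]\<^bsub>?G\<^esub> p \<otimes>\<^bsub>?G\<^esub> ?A [^]\<^bsub>?G\<^esub> i \<otimes>\<^bsub>?G\<^esub> ?Y) \<otimes>\<^bsub>?G\<^esub> m_inv ?G ?A"
        unfolding A1 using A B Y by (simp add: m_assoc)
      also have "\<dots> = ?B [^]\<^bsub>?G\<^esub> (n * q) \<otimes>\<^bsub>?G\<^esub> (?A [^]\<^bsub>?G\<^esub> Suc j \<otimes>\<^bsub>?G\<^esub> m_inv ?G ?A)"
        unfolding IH nat_pow_Suc2[OF A] using A B by (simp add: comm1' flip: m_assoc)
      also have "\<dots> = ?B [^]\<^bsub>?G\<^esub> (n * q) \<otimes>\<^bsub>?G\<^esub> ?A [^]\<^bsub>?G\<^esub> j"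
        using A B by (simp add: m_assoc)
      finally show ?thesis
        unfolding snoc_eq L by blast
    next
      case b
      have L: "word_class (BS1_rel n) [l] = ?B" by (simp add: b BS1_b_def)
      have "?B [^]\<^bsub>?G\<^esub> p \<otimes>\<^bsub>?G\<^esub> ?A [^]\<^bsub>?G\<^esub> i \<otimes>\<^bsub>?G\<^esub> (?Y \<otimes>\<^bsub>?G\<^esub> ?B)
          = ?B [^]\<^bsub>?G\<^esub> q \<otimes>\<^bsub>?G\<^esub> ?A [^]\<^bsub>?G\<^esub> j \<otimes>\<^bsub>?G\<^esub> ?B"
        using A B Y IH by (simp flip: m_assoc)
      also have "\<dots> = ?B [^]\<^bsub>?G\<^esub> (q + n ^ j) \<otimes>\<^bsub>?G\<^esub> ?A [^]\<^bsub>?G\<^esub> j"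
        using A B by (simp add: m_assoc comm1) (simp add: nat_pow_mult flip: m_assoc)
      finally show ?thesis
        unfolding snoc_eq L by blast
    next
      case b'
      have L: "word_class (BS1_rel n) [l] = m_inv ?G ?B"
        by (simp add: b' BS1_b_def BS1_inverse_letter)
      have "?B [^]\<^bsub>?G\<^esub> (n ^ j + p) \<otimes>\<^bsub>?G\<^esub> ?A [^]\<^bsub>?G\<^esub> i \<otimes>\<^bsub>?G\<^esub> (?Y \<otimes>\<^bsub>?G\<^esub> m_inv ?G ?B)
          = ?B [^]\<^bsub>?G\<^esub> (n ^ j) \<otimes>\<^bsub>?G\<^esub> (?B [^]\<^bsub>?G\<^esub> p \<otimes>\<^bsub>?G\<^esub> ?A [^]\<^bsub>?G\<^esub> i \<otimes>\<^bsub>?G\<^esub> ?Y) \<otimes>\<^bsub>?G\<^esub> m_inv ?G ?B"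
        using A B Y by (simp add: m_assoc flip: nat_pow_mult)
      also have "\<dots> = ?B [^]\<^bsub>?G\<^esub> (q + n ^ j) \<otimes>\<^bsub>?G\<^esub> ?A [^]\<^bsub>?G\<^esub> j \<otimes>\<^bsub>?G\<^esub> m_inv ?G ?B"
        unfolding IH using A B by (simp add: nat_pow_mult add.commute flip: m_assoc)
      also have "\<dots> = ?B [^]\<^bsub>?G\<^esub> q \<otimes>\<^bsub>?G\<^esub> (?B [^]\<^bsub>?G\<^esub> (n ^ j) \<otimes>\<^bsub>?G\<^esub> ?A [^]\<^bsub>?G\<^esub> j) \<otimes>\<^bsub>?G\<^esub> m_inv ?G ?B"
        using A B by (simp add: nat_pow_mult flip: m_assoc)
      also have "\<dots> = ?B [^]\<^bsub>?G\<^esub> q \<otimes>\<^bsub>?G\<^esub> ?A [^]\<^bsub>?G\<^esub> j"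
        using A B by (simp add: m_assoc flip: comm1)
      finally show ?thesis
        unfolding snoc_eq L by blast
    qed
  qed
qed

section \<open>Faithfulness\<close>

text \<open>Elements are told apart by the affine maps \<open>x \<mapsto> n\<^sup>i x + p\<close> of the first coordinate,
  irrespective of the angle. If \<open>X\<close> acts trivially and \<open>b\<^sup>p a\<^sup>i X = b\<^sup>q a\<^sup>j\<close>, then evaluation at
  \<open>0\<close> and \<open>1\<close> gives \<open>p = q\<close> and \<open>n\<^sup>i = n\<^sup>j\<close>, hence \<open>X = 1\<close>.\<close>

lemma BS1_action_faithful:
  fixes n :: nat
  assumes n: "n \<ge> 2"
  shows "faithful_BS1_action n f\<^sub>0 (affine_torus_map (real n) 0 s)"
proof -
  let ?h = "affine_torus_map (real n) 0 s"
  define \<sigma> where "\<sigma> x = (case x of gen_a \<Rightarrow> ?h | gen_b \<Rightarrow> f\<^sub>0)" for x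
  have \<sigma>: "\<exists>\<alpha> \<beta> r. \<alpha> \<noteq> 0 \<and> \<sigma> x = affine_torus_map \<alpha> \<beta> r" for x
  proof (cases x)
    case gen_a
    with n have "real n \<noteq> 0 \<and> \<sigma> x = affine_torus_map (real n) 0 s"
      by (simp add: \<sigma>_def)
    then show ?thesis by blast
  next
    case gen_b
    then have "(1 :: real) \<noteq> 0 \<and> \<sigma> x = affine_torus_map 1 1 0"
      by (simp add: \<sigma>_def f0_eq_affine)
    then show ?thesis by blast
  qed
  have bij: "bij (\<sigma> x)" for x
    using \<sigma>[of x] affine_torus_map_inverse(1) by auto
  have f_pow: "f\<^sub>0 ^^ k = affine_torus_map 1 (real k) 0" for k
    by (simp add: f0_eq_affine affine_torus_map_funpow)
  have rel: "?h \<circ> f\<^sub>0 \<circ> inv ?h = f\<^sub>0 ^^ n"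
    using n unfolding f_pow
    by (simp add: f0_eq_affine affine_torus_map_inverse affine_torus_map_compose)
  have "eval_word \<sigma> (replicate k (gen_b, True)) = f\<^sub>0 ^^ k" for k
    by (induction k) (simp_all add: \<sigma>_def)
  with rel have "eval_word \<sigma> u = eval_word \<sigma> v" if "(u, v) \<in> BS1_rel n" for u v
    using that by (auto simp: BS1_rel_def \<sigma>_def comp_assoc)
  from presented_group_action[OF bij this] obtain \<rho>
    where \<rho>: "\<And>u. \<rho> (word_class (BS1_rel n) u) = eval_word \<sigma> u"
    by blast
  have affine: "\<exists>\<alpha> \<beta> r. \<alpha> \<noteq> 0 \<and> eval_word \<sigma> u = affine_torus_map \<alpha> \<beta> r" for u
  proof (induction u)
    case Nil
    then show ?case using affine_torus_map_id by (metis eval_word.simps(1) zero_neq_one)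
  next
    case (Cons l u)
    from \<sigma>[of "fst l"] obtain \<alpha> \<beta> r where 1: "\<alpha> \<noteq> 0" "\<sigma> (fst l) = affine_torus_map \<alpha> \<beta> r"
      by blast
    from Cons.IH obtain \<alpha>' \<beta>' r' where 2: "\<alpha>' \<noteq> 0" "eval_word \<sigma> u = affine_torus_map \<alpha>' \<beta>' r'"
      by blast
    show ?case
    proof (cases "snd l")
      case True
      then have "eval_word \<sigma> (l # u) = affine_torus_map (\<alpha> * \<alpha>') (\<alpha> * \<beta>' + \<beta>) (r + r')"
        by (simp add: 1 2 affine_torus_map_compose)
      with 1 2 show ?thesis by (metis mult_eq_0_iff)
    next
      case False
      then have "eval_word \<sigma> (l # u) =
          affine_torus_map (1 / \<alpha> * \<alpha>') (1 / \<alpha> * \<beta>' + - \<beta> / \<alpha>) (- r + r')"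
        by (simp add: 1 2 affine_torus_map_inverse affine_torus_map_compose)
      moreover have "1 / \<alpha> * \<alpha>' \<noteq> 0" using 1 2 by simp
      ultimately show ?thesis by blast
    qed
  qed
  interpret group "BS1 n" by (rule group_BS1)
  let ?G = "BS1 n"
  have \<rho>_mult: "\<rho> (X \<otimes>\<^bsub>?G\<^esub> Y) = \<rho> X \<circ> \<rho> Y" if "X \<in> carrier ?G" "Y \<in> carrier ?G" for X Y
    using that by (auto simp: BS1_carrier BS1_mult \<rho> eval_word_append)
  have \<rho>_one: "\<rho> \<one>\<^bsub>?G\<^esub> = id"
    by (simp add: BS1_one \<rho>)
  have \<rho>_pow: "\<rho> (X [^]\<^bsub>?G\<^esub> k) = \<rho> X ^^ k" if "X \<in> carrier ?G" for X and k :: nat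
    using that by (induction k) (simp_all add: \<rho>_one \<rho>_mult funpow_Suc_right del: funpow.simps(2))
  have a: "BS1_a n \<in> carrier ?G" "\<rho> (BS1_a n) = ?h" and b: "BS1_b n \<in> carrier ?G" "\<rho> (BS1_b n) = f\<^sub>0"
    by (simp_all add: BS1_a_def BS1_b_def BS1_carrier \<rho> \<sigma>_def)
  have hom: "\<rho> \<in> hom ?G diffeo_group"
  proof (rule homI)
    show "\<rho> X \<in> carrier diffeo_group" if "X \<in> carrier ?G" for X
      using that affine torus_diffeo_affine_torus_map
      by (auto simp: BS1_carrier \<rho> diffeo_group_def) metis
  qed (simp add: \<rho>_mult diffeo_group_def)
  have kernel: "X = \<one>\<^bsub>?G\<^esub>" if X: "X \<in> carrier ?G" and "\<rho> X = id" for X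
  proof -
    from BS1_positive_form[OF X] obtain p i q j :: nat
      where eq: "BS1_b n [^]\<^bsub>?G\<^esub> p \<otimes>\<^bsub>?G\<^esub> BS1_a n [^]\<^bsub>?G\<^esub> i \<otimes>\<^bsub>?G\<^esub> X
        = BS1_b n [^]\<^bsub>?G\<^esub> q \<otimes>\<^bsub>?G\<^esub> BS1_a n [^]\<^bsub>?G\<^esub> j"
      by blast
    from arg_cong[OF eq, of \<rho>] have "affine_torus_map (real n ^ i) (real p) (real i * s)
        = affine_torus_map (real n ^ j) (real q) (real j * s)"
      using a b X \<open>\<rho> X = id\<close>
      by (simp add: \<rho>_mult \<rho>_pow f_pow affine_torus_map_funpow affine_torus_map_compose)
    from arg_cong[OF this, of "\<lambda>f. fst (f (Some x, to_circle 0))" for x]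
    have "real n ^ i * x + real p = real n ^ j * x + real q" for x
      by (simp add: affine_torus_map_def)
    from this[of 0] this[of 1] have "p = q" "n ^ i = n ^ j"
      by (simp_all flip: of_nat_power)
    with n have "i = j" by simp
    with eq \<open>p = q\<close> show ?thesis
      using a b X by simp
  qed
  have "inj_on \<rho> (carrier ?G)"
  proof (rule inj_onI)
    fix X Y assume X: "X \<in> carrier ?G" and Y: "Y \<in> carrier ?G" and "\<rho> X = \<rho> Y"
    then have "\<rho> (m_inv ?G X \<otimes>\<^bsub>?G\<^esub> Y) = \<rho> (m_inv ?G X \<otimes>\<^bsub>?G\<^esub> X)"
      by (simp only: \<rho>_mult inv_closed)
    also have "\<dots> = id"
      using X by (simp add: \<rho>_one)
    finally have "m_inv ?G X \<otimes>\<^bsub>?G\<^esub> Y = \<one>\<^bsub>?G\<^esub>"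
      using X Y by (intro kernel) simp_all
    with X Y show "X = Y"
      by (metis inv_closed inv_inv inv_equality inv_comm)
  qed
  moreover have "torus_diffeo f\<^sub>0" "torus_diffeo ?h"
    using n by (simp_all add: f0_eq_affine torus_diffeo_affine_torus_map)
  ultimately show ?thesis
    unfolding faithful_BS1_action_def smooth_BS1_action_def
    using hom rel a(2) b(2) unfolding BS1_a_def BS1_b_def by blast
qed

section \<open>Non-conjugacy\<close>

text \<open>A conjugacy preserves the fixed point set of \<open>f\<^sub>0\<close>, which is the circle at infinity. There the
  other generators are the rotations by \<open>s\<close> and \<open>s'\<close>, and conjugate maps have the same periods.\<close>

lemma conjugate_fixed_circle_rotations:
  assumes "topologically_conjugate f\<^sub>0 (affine_torus_map \<alpha> 0 s) f\<^sub>0 (affine_torus_map \<alpha>' 0 s')"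
  shows "real q * s \<in> \<int> \<longleftrightarrow> real q * s' \<in> \<int>"
proof -
  let ?h = "affine_torus_map \<alpha> 0 s" and ?h' = "affine_torus_map \<alpha>' 0 s'"
  from assms obtain H where H: "homeomorphic_map torus_top torus_top H"
    and Hf: "H \<circ> f\<^sub>0 \<circ> inv H = f\<^sub>0" and Hh: "H \<circ> ?h \<circ> inv H = ?h'"
    unfolding topologically_conjugate_def by blast
  from H have inj: "inj H" and surj: "surj H"
    by (auto simp: homeomorphic_eq_everything_map)
  have f: "H (f\<^sub>0 z) = f\<^sub>0 (H z)" and h: "H (?h z) = ?h' (H z)" for z
    using fun_cong[OF Hf, of "H z"] fun_cong[OF Hh, of "H z"] inj by simp_all
  have hq: "H ((?h ^^ q) z) = (?h' ^^ q) (H z)" for z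
    by (induction q) (simp_all add: h)
  have fixed: "f\<^sub>0 z = z \<longleftrightarrow> fst z = None" for z
    by (cases z; cases "fst z") (auto simp: f\<^sub>0_def)
  obtain c where c: "H (None, to_circle 0) = (None, c)"
    using f[of "(None, to_circle 0)"] fixed[of "(None, to_circle 0)"]
      fixed[of "H (None, to_circle 0)"] by (cases "H (None, to_circle 0)") auto
  have power: "(affine_torus_map \<alpha> 0 s ^^ q) (None, x) = (None, x) \<longleftrightarrow> real q * s \<in> \<int>" for \<alpha> s x
    by (simp add: affine_torus_map_funpow, simp add: affine_torus_map_def rotate_circle_eq_self_iff)
  have "(?h ^^ q) (None, to_circle 0) = (None, to_circle 0) \<longleftrightarrow> (?h' ^^ q) (None, c) = (None, c)"
    using hq[of "(None, to_circle 0)"] inj c by (metis injD)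
  then show ?thesis
    by (simp add: power)
qed

text \<open>If \<open>l\<close> is rational, a small rational perturbation changes the order of the rotation by \<open>l\<close>; if
  \<open>l\<close> is irrational, it is a limit of rational angles, whose rotations have finite order. So the
  argument does not depend on whether \<open>ln n\<close> is rational.\<close>

lemma dense_angles_of_different_order:
  "l \<in> closure {s :: real. \<exists>q :: nat. (real q * s \<in> \<int>) \<noteq> (real q * l \<in> \<int>)}"
  unfolding closure_approachable
proof (intro allI impI)
  fix e :: real assume "e > 0"
  obtain m :: nat where m: "m > 1" "1 / real m < e"
  proof -
    obtain m where "1 / real (Suc m) < e"
      using nat_approx_posE[OF \<open>e > 0\<close>] by blast
    moreover have "1 / real (Suc (Suc m)) \<le> 1 / real (Suc m)"
      by (simp add: frac_le)
    ultimately show thesis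
      by (intro that[of "Suc (Suc m)"]) linarith+
  qed
  show "\<exists>s\<in>{s. \<exists>q :: nat. (real q * s \<in> \<int>) \<noteq> (real q * l \<in> \<int>)}. dist s l < e"
  proof (cases "\<exists>q > 0. real q * l \<in> \<int>")
    case True
    then obtain q :: nat where q: "q > 0" "real q * l \<in> \<int>" by blast
    \<comment> \<open>Then \<open>q ?s\<close> and \<open>q l\<close> differ by \<open>1 / m\<close>, which is not an integer.\<close>
    let ?s = "l + 1 / (real q * real m)"
    have "real q * ?s - real q * l = 1 / real m"
      using q by (simp add: field_simps)
    moreover have "1 / real m \<notin> \<int>"
    proof
      assume "1 / real m \<in> \<int>"
      then obtain k :: int where "1 / real m = of_int k" by (rule Ints_cases)
      moreover have "0 < 1 / real m" "1 / real m < 1" using m(1) by simp_all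
      ultimately have "0 < k" "k < 1" by simp_all
      then show False by simp
    qed
    ultimately have "real q * ?s \<notin> \<int>"
      using q(2) Ints_diff by metis
    moreover have "1 / (real q * real m) \<le> 1 / real m"
      using q(1) m(1) by (intro divide_left_mono) simp_all
    then have "dist ?s l < e"
      using m by (simp add: dist_real_def)
    ultimately show ?thesis
      using q(2) by blast
  next
    case False
    let ?s = "of_int \<lfloor>real m * l\<rfloor> / real m"
    have "real m * ?s \<in> \<int>"
      using m(1) by simp
    moreover have "real m * l \<notin> \<int>"
      using m(1) False less_trans[OF zero_less_one m(1)] by blast
    moreover have "\<bar>?s - l\<bar> = (real m * l - of_int \<lfloor>real m * l\<rfloor>) / real m"
    proof -
      have "?s - l = - ((real m * l - of_int \<lfloor>real m * l\<rfloor>) / real m)"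
        using m(1) by (simp add: field_simps)
      then show ?thesis
        by (simp only: abs_minus_cancel) simp
    qed
    moreover have "(real m * l - of_int \<lfloor>real m * l\<rfloor>) / real m \<le> 1 / real m"
      by (intro divide_right_mono) linarith+
    ultimately show ?thesis
      using m(2) by (intro bexI[of _ ?s]) (auto simp: dist_real_def)
  qed
qed

theorem corollary1:
  fixes n :: nat
  assumes "n \<ge> 2"
  shows "(f\<^sub>0, h\<^sub>0 n) \<in> prod_topology smooth_topology smooth_topology closure_of
           {(f, h). faithful_BS1_action n f h \<and> \<not> topologically_conjugate f h f\<^sub>0 (h\<^sub>0 n)}"
proof -
  let ?l = "ln (real n)" and ?h = "affine_torus_map (real n) 0"
  \<comment> \<open>The first generator stays \<open>f\<^sub>0\<close>; only the angle of the second one varies.\<close>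
  let ?S = "{s. \<exists>q :: nat. (real q * s \<in> \<int>) \<noteq> (real q * ?l \<in> \<int>)}"
  have n: "real n \<noteq> 0" using assms by simp
  have "f\<^sub>0 \<in> topspace smooth_topology"
    unfolding topspace_smooth_topology f0_eq_affine
    using torus_diffeo_affine_torus_map[of 1] by (simp add: torus_diffeo_def)
  then have "continuous_map euclidean (prod_topology smooth_topology smooth_topology) (\<lambda>s. (f\<^sub>0, ?h s))"
    using continuous_map_rotation_angle[OF n] by (simp add: continuous_map_pairedI)
  from continuous_map_image_closure_subset[OF this, of ?S]
  have "(f\<^sub>0, ?h ?l) \<in> prod_topology smooth_topology smooth_topology closure_of ((\<lambda>s. (f\<^sub>0, ?h s)) ` ?S)"
    using dense_angles_of_different_order[of ?l] unfolding euclidean_closure_of by blast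
  moreover have "(\<lambda>s. (f\<^sub>0, ?h s)) ` ?S \<subseteq>
      {(f, h). faithful_BS1_action n f h \<and> \<not> topologically_conjugate f h f\<^sub>0 (h\<^sub>0 n)}"
    using BS1_action_faithful[OF assms] conjugate_fixed_circle_rotations
    unfolding h0_eq_affine by blast
  ultimately show ?thesis
    unfolding h0_eq_affine using closure_of_mono by blast
qed

end
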